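(* Let $X$ be a reflexive real Banach space with dual $X^\ast$, let $S\colon X\rightrightarrows X^\ast$ be maximally monotone, let $h\in\mathcal{H}(S)$, and let $T\colon X\rightrightarrows X^\ast$ be a point-to-set operator. Let $x\in\operatorname{dom} S$. Then: (i) If $\operatorname{dom} T$ is bounded, then $\mathcal{D}_T^{\flat,h}(x,\cdot)$ is supercoercive and hence coercive. Suppose further that $T$ has strongly compact images. Then the following hold: (ii) If, for all sequences, $(a_n,b_n)\in\mathcal{G}(S)$, $(y_n,v_n)\in\mathcal{G}(T)$, and $\|y_n-a_n\|\to\infty$ imply $\|v_n-b_n\|\to\infty$, then $\mathcal{D}_T^{\flat,h}(x,\cdot)$ is coercive. (iii) If, for all sequences, $(a_n,b_n)\in\mathcal{G}(S)$, $(y_n,v_n)\in\mathcal{G}(T)$, and $\|y_n-a_n\|\to\infty$ imply $\|v_n-b_n\|^2/\|y_n-a_n\|\to\infty$, then $\mathcal{D}_T^{\flat,h}(x,\cdot)$ is supercoercive.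
   Context: For a maximally monotone operator $S\colon X\rightrightarrows X^\ast$ with graph $\mathcal{G}(S)$, a function $h\colon X\times X^\ast\to\left]-\infty,+\infty\right]$ represents $S$, written $h\in\mathcal{H}(S)$, if (a) $h$ is convex and norm $\times$ weak$^\ast$ lower semicontinuous; (b) $h(x,v)\geq\langle x,v\rangle$ for all $(x,v)\in X\times X^\ast$; (c) $h(x,v)=\langle x,v\rangle$ if and only if $(x,v)\in\mathcal{G}(S)$. For an operator $A$, $\operatorname{dom} A=\{x: Ax\neq\varnothing\}$ and $\mathcal{G}(A)$ is its graph. Generalized Bregman distance: for $(x,y)\in\operatorname{dom} S\times\operatorname{dom} T$, $$\mathcal{D}_T^{\flat,h}(x,y):=\inf_{v\in Ty}\big(h(x,v)-\langle x,v\rangle\big),$$ and $\mathcal{D}_T^{\flat,h}(x,y):=+\infty$ if $x\notin\operatorname{dom} S$ or $y\notin\operatorname{dom} T$. A function $g\colon X\to\left]-\infty,+\infty\right]$ is coercive if $\lim_{\|x\|\to\infty}g(x)=\infty$ and supercoercive if $\lim_{\|x\|\to\infty}g(x)/\|x\|=\infty$. *)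

theory Defs
  imports "HOL-Analysis.Analysis"
begin

text \<open>The dual of \<open>'a\<close> is the normed space \<open>'a \<Rightarrow>\<^sub>L real\<close>, with duality pairing
  \<open>\<langle>x, v\<rangle> = blinfun_apply v x\<close>. A point-to-set operator is a function \<open>'a \<Rightarrow> ('a \<Rightarrow>\<^sub>L real) set\<close>.\<close>

text \<open>\<open>blinfun.prod_left x\<close> is the evaluation functional \<open>\<lambda>v. blinfun_apply v x\<close>, so it is the
  canonical embedding into the bidual.\<close>

definition reflexive_space :: "'a::real_normed_vector itself \<Rightarrow> bool" where
  "reflexive_space _ \<longleftrightarrow>
    surj (blinfun.prod_left :: 'a \<Rightarrow> (('a \<Rightarrow>\<^sub>L real) \<Rightarrow>\<^sub>L real))"

definition op_graph :: "('a \<Rightarrow> 'b set) \<Rightarrow> ('a \<times> 'b) set" where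
  "op_graph A = {(x, v). v \<in> A x}"

definition op_dom :: "('a \<Rightarrow> 'b set) \<Rightarrow> 'a set" where
  "op_dom A = {x. A x \<noteq> {}}"

definition monotone_operator ::
  "('a::real_normed_vector \<Rightarrow> ('a \<Rightarrow>\<^sub>L real) set) \<Rightarrow> bool" where
  "monotone_operator A \<longleftrightarrow>
    (\<forall>(x, u) \<in> op_graph A. \<forall>(y, v) \<in> op_graph A. 0 \<le> blinfun_apply (u - v) (x - y))"

definition maximally_monotone ::
  "('a::real_normed_vector \<Rightarrow> ('a \<Rightarrow>\<^sub>L real) set) \<Rightarrow> bool" where
  "maximally_monotone A \<longleftrightarrow> monotone_operator A \<and>
    (\<forall>B. monotone_operator B \<and> op_graph A \<subseteq> op_graph B \<longrightarrow> op_graph B = op_graph A)"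

text \<open>For real-valued functionals the topology of pointwise convergence, which the library calls
  the strong operator topology, is the weak* topology.\<close>

abbreviation weak_star_topology :: "('a::real_normed_vector \<Rightarrow>\<^sub>L real) topology" where
  "weak_star_topology \<equiv> strong_operator_topology"

definition lsc_wrt :: "'b topology \<Rightarrow> ('b \<Rightarrow> ereal) \<Rightarrow> bool" where
  "lsc_wrt \<tau> f \<longleftrightarrow> (\<forall>c::real. openin \<tau> {p \<in> topspace \<tau>. ereal c < f p})"

text \<open>Meant for functions that never take the value \<open>-\<infinity>\<close>, so that the right-hand side is
  unambiguous.\<close>

definition ereal_convex :: "('b::real_vector \<Rightarrow> ereal) \<Rightarrow> bool" where
  "ereal_convex f \<longleftrightarrow> (\<forall>p q. \<forall>t::real. 0 < t \<and> t < 1 \<longrightarrow>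
    f ((1 - t) *\<^sub>R p + t *\<^sub>R q) \<le> ereal (1 - t) * f p + ereal t * f q)"

definition represents ::
  "('a::real_normed_vector \<times> ('a \<Rightarrow>\<^sub>L real) \<Rightarrow> ereal) \<Rightarrow> ('a \<Rightarrow> ('a \<Rightarrow>\<^sub>L real) set) \<Rightarrow> bool" where
  "represents h S \<longleftrightarrow>
    (\<forall>p. h p \<noteq> -\<infinity>) \<and>
    ereal_convex h \<and> lsc_wrt (prod_topology euclidean weak_star_topology) h \<and>
    (\<forall>x v. ereal (blinfun_apply v x) \<le> h (x, v)) \<and>
    (\<forall>x v. h (x, v) = ereal (blinfun_apply v x) \<longleftrightarrow> (x, v) \<in> op_graph S)"

definition bregman_flat ::
  "('a::real_normed_vector \<Rightarrow> ('a \<Rightarrow>\<^sub>L real) set) \<Rightarrow> ('a \<Rightarrow> ('a \<Rightarrow>\<^sub>L real) set) \<Rightarrow>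
    ('a \<times> ('a \<Rightarrow>\<^sub>L real) \<Rightarrow> ereal) \<Rightarrow> 'a \<Rightarrow> 'a \<Rightarrow> ereal" where
  "bregman_flat S T h x y =
    (if x \<in> op_dom S \<and> y \<in> op_dom T
     then INF v \<in> T y. h (x, v) - ereal (blinfun_apply v x) else \<infinity>)"

definition coercive :: "('a::real_normed_vector \<Rightarrow> ereal) \<Rightarrow> bool" where
  "coercive g \<longleftrightarrow> (g \<longlongrightarrow> \<infinity>) at_infinity"

definition supercoercive :: "('a::real_normed_vector \<Rightarrow> ereal) \<Rightarrow> bool" where
  "supercoercive g \<longleftrightarrow> ((\<lambda>x. g x / ereal (norm x)) \<longlongrightarrow> \<infinity>) at_infinity"

end

theory Submission
  imports Defs
begin

text \<open>If \<open>dom T\<close> is bounded, the distance is \<open>\<infinity>\<close> off a ball. The other parts rest on the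
  estimate that \<open>h(x,v) - \<langle>x,v\<rangle> \<le> M\<close> forces a point \<open>(a,b)\<close> of the graph of \<open>S\<close> with
  \<open>\<parallel>a - x\<parallel>\<^sup>2 + \<parallel>b - v\<parallel>\<^sup>2 \<le> 2M\<close>. Applied along a sequence
  \<open>y\<^sub>n\<close>, \<open>v\<^sub>n \<in> T y\<^sub>n\<close> violating (super)coercivity, it keeps \<open>a\<^sub>n\<close> close to \<open>x\<close>, hence far from \<open>y\<^sub>n\<close>, while \<open>b\<^sub>n\<close> stays too close to \<open>v\<^sub>n\<close>. The estimate
  is Fenchel duality between \<open>h\<close>, recentred at \<open>(x,v)\<close>, and half the squared norm.\<close>

section \<open>Hahn-Banach: linear minorants of sublinear functionals\<close>

text \<open>Homogeneity is asked as an inequality because pointwise infima inherit it directly; the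
  reverse inequality follows by scaling with \<open>inverse t\<close>.\<close>

definition sublinear :: "('a::real_vector \<Rightarrow> real) \<Rightarrow> bool" where
  "sublinear q \<longleftrightarrow>
    (\<forall>x y. q (x + y) \<le> q x + q y) \<and> (\<forall>t>0. \<forall>x. q (t *\<^sub>R x) \<le> t * q x)"

text \<open>Zorn's lemma for the reversed pointwise order. A chain is bounded below by its pointwise
  infimum, which is finite because all candidates share one lower bound.\<close>

lemma minimal_sublinear:
  fixes p :: "'a::real_vector \<Rightarrow> real"
  assumes p: "sublinear p"
  obtains m where "sublinear m" "m \<le> p" "\<And>q. sublinear q \<Longrightarrow> q \<le> m \<Longrightarrow> q = m"
proof -
  have zero: "q 0 \<ge> 0" if "sublinear q" for q :: "'a \<Rightarrow> real"
  proof -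
    have "q (0 + 0) \<le> q 0 + q 0"
      using that unfolding sublinear_def by blast
    then show ?thesis by simp
  qed
  define A where "A = {q. sublinear q \<and> q \<le> p}"
  \<comment> \<open>The bound depends on \<open>p\<close> and \<open>x\<close> only, so it serves
    all of \<open>A\<close> at once.\<close>
  have low: "- p (- x) \<le> q x" if "q \<in> A" for q x
  proof -
    have "q (x + - x) \<le> q x + q (- x)"
      using that unfolding A_def sublinear_def by blast
    moreover have "q (- x) \<le> p (- x)"
      using that unfolding A_def le_fun_def by blast
    ultimately show ?thesis
      using zero[of q] that by (simp add: A_def)
  qed
  have "\<exists>m\<in>A. \<forall>q\<in>A. q \<le> m \<longrightarrow> q = m"
  proof (rule predicate_Zorn[where P = "\<lambda>f g. g \<le> f"])
    show "partial_order_on A (relation_of (\<lambda>f g. g \<le> f) A)"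
      by (rule partial_order_on_relation_ofI) auto
    fix C assume C: "C \<in> Chains (relation_of (\<lambda>f g. g \<le> f) A)"
    then have CA: "C \<subseteq> A" and tot: "\<And>f g. f \<in> C \<Longrightarrow> g \<in> C \<Longrightarrow> f \<le> g \<or> g \<le> f"
      unfolding Chains_def relation_of_def by blast+
    show "\<exists>u\<in>A. \<forall>a\<in>C. u \<le> a"
    proof (cases "C = {}")
      case True
      then show ?thesis using p by (auto simp: A_def)
    next
      case False
      define u where "u = (\<lambda>x. INF q\<in>C. q x)"
      have bdd: "bdd_below ((\<lambda>q. q x) ` C)" for x
        by (rule bdd_belowI2[of _ "- p (- x)"]) (use low CA in blast)
      have le: "u x \<le> q x" if "q \<in> C" for q x
        unfolding u_def by (rule cINF_lower[OF bdd that])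
      have ge: "c \<le> u x" if "\<And>q. q \<in> C \<Longrightarrow> c \<le> q x" for c x
        unfolding u_def by (rule cINF_greatest[OF False that])
      have sub: "sublinear q" if "q \<in> C" for q using that CA by (auto simp: A_def)
      have "u (x + y) \<le> u x + u y" for x y
      proof -
        \<comment> \<open>Subadditivity of the infimum needs a single functional at both points: of
          two members of a chain, the smaller one does.\<close>
        have "u (x + y) - q x \<le> r y" if q: "q \<in> C" and r: "r \<in> C" for q r
        proof (cases "q \<le> r")
          case True
          have "u (x + y) \<le> q (x + y)" using le q by blast
          also have "\<dots> \<le> q x + q y" using sub[OF q] by (simp add: sublinear_def)
          finally show ?thesis using le_funD[OF True, of y] by simp
        next
          case False
          then have rq: "r \<le> q" using tot q r by blast
          have "u (x + y) \<le> r (x + y)" using le r by blast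
          also have "\<dots> \<le> r x + r y" using sub[OF r] by (simp add: sublinear_def)
          finally show ?thesis using le_funD[OF rq, of x] by simp
        qed
        then have "u (x + y) - q x \<le> u y" if "q \<in> C" for q
          using that by (intro ge) blast
        then have "u (x + y) - u y \<le> u x"
          by (intro ge) (smt (verit))
        then show ?thesis by simp
      qed
      moreover have "u (t *\<^sub>R x) \<le> t * u x" if "t > 0" for t x
      proof -
        have "u (t *\<^sub>R x) / t \<le> q x" if "q \<in> C" for q
        proof -
          have "u (t *\<^sub>R x) \<le> q (t *\<^sub>R x)" using le that by blast
          also have "\<dots> \<le> t * q x" using sub[OF that] \<open>t > 0\<close> by (simp add: sublinear_def)
          finally show ?thesis using \<open>t > 0\<close> by (simp add: field_simps)
        qed
        then have "u (t *\<^sub>R x) / t \<le> u x"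
          by (rule ge)
        then show ?thesis using that by (simp add: field_simps)
      qed
      ultimately have "sublinear u" by (simp add: sublinear_def)
      moreover obtain q where "q \<in> C" using False by blast
      then have "u \<le> q" "q \<le> p" using le CA by (auto simp: A_def le_fun_def)
      then have "u \<le> p" by (rule order_trans)
      ultimately show ?thesis using le by (auto simp: A_def le_fun_def)
    qed
  qed
  then obtain m where "m \<in> A" "\<And>q. q \<in> A \<Longrightarrow> q \<le> m \<Longrightarrow> q = m" by blast
  then show ?thesis
    by (intro that[of m]) (auto simp: A_def)
qed

text \<open>A minimal sublinear functional is linear, since it can be lowered along any \<open>v\<close> until it is odd
  there.\<close>

lemma linear_below_sublinear:
  fixes p :: "'a::real_vector \<Rightarrow> real"
  assumes "sublinear p"
  obtains f where "linear f" "\<And>x. f x \<le> p x"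
proof -
  obtain m where m: "sublinear m" and "m \<le> p"
    and min: "\<And>q. sublinear q \<Longrightarrow> q \<le> m \<Longrightarrow> q = m"
    using minimal_sublinear[OF assms] by blast
  have sub: "m (x + y) \<le> m x + m y" for x y
    using m by (simp add: sublinear_def)
  have hom: "m (t *\<^sub>R x) \<le> t * m x" if "t > 0" for t x
    using m that by (simp add: sublinear_def)
  have m0: "m 0 = 0"
    using sub[of 0 0] hom[of "1/2" 0] by simp
  have odd: "m (- v) = - m v" for v
  proof -
    \<comment> \<open>\<open>q\<close> is \<open>m\<close> lowered along \<open>v\<close>. It is
      again sublinear and below \<open>m\<close>, so minimality gives \<open>q = m\<close>; the
      choice \<open>z = - v\<close>, \<open>t = 1\<close> then yields oddness at
      \<open>v\<close>.\<close>
    define q where "q = (\<lambda>z. INF t\<in>{0..}. m (z + t *\<^sub>R v) - t * m v)"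
    have low: "- m (- z) \<le> m (z + t *\<^sub>R v) - t * m v" if "t \<ge> 0" for z t
    proof (cases "t = 0")
      case True
      then show ?thesis using sub[of z "- z"] m0 by simp
    next
      case False
      then have t: "t > 0" using that by simp
      have "m v \<le> inverse t * m (t *\<^sub>R v)"
        using hom[of "inverse t" "t *\<^sub>R v"] t by simp
      then have "t * m v \<le> m (t *\<^sub>R v)" using t by (simp add: field_simps)
      also have "\<dots> \<le> m (z + t *\<^sub>R v) + m (- z)"
        using sub[of "z + t *\<^sub>R v" "- z"] by simp
      finally show ?thesis by simp
    qed
    have bdd: "bdd_below ((\<lambda>t. m (z + t *\<^sub>R v) - t * m v) ` {0..})" for z
      by (rule bdd_belowI2[of _ "- m (- z)"]) (use low in auto)
    have le: "q z \<le> m (z + t *\<^sub>R v) - t * m v" if "t \<ge> 0" for z t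
      unfolding q_def by (rule cINF_lower[OF bdd]) (use that in simp)
    have ge: "c \<le> q z" if "\<And>t. t \<ge> 0 \<Longrightarrow> c \<le> m (z + t *\<^sub>R v) - t * m v" for c z
      unfolding q_def by (rule cINF_greatest) (use that in auto)
    have "q (x + y) \<le> q x + q y" for x y
    proof -
      have *: "q (x + y) \<le> (m (x + t *\<^sub>R v) - t * m v) + (m (y + s *\<^sub>R v) - s * m v)"
        if "t \<ge> 0" "s \<ge> 0" for t s
      proof -
        have "q (x + y) \<le> m ((x + t *\<^sub>R v) + (y + s *\<^sub>R v)) - (t + s) * m v"
          using le[of "t + s" "x + y"] that by (simp add: algebra_simps)
        then show ?thesis
          using sub[of "x + t *\<^sub>R v" "y + s *\<^sub>R v"] by (simp add: algebra_simps)
      qed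
      have "q (x + y) - (m (x + t *\<^sub>R v) - t * m v) \<le> q y" if "t \<ge> 0" for t
        by (rule ge) (use * that in \<open>smt (verit)\<close>)
      then have "q (x + y) - q y \<le> q x"
        by (intro ge) (smt (verit))
      then show ?thesis by simp
    qed
    moreover have "q (c *\<^sub>R x) \<le> c * q x" if c: "c > 0" for c x
    proof -
      have "q (c *\<^sub>R x) / c \<le> q x"
      proof (rule ge)
        fix t :: real assume "t \<ge> 0"
        then have "q (c *\<^sub>R x) \<le> m (c *\<^sub>R (x + t *\<^sub>R v)) - (c * t) * m v"
          using le[of "c * t" "c *\<^sub>R x"] c by (simp add: algebra_simps)
        also have "\<dots> \<le> c * (m (x + t *\<^sub>R v) - t * m v)"
          using hom[OF c, of "x + t *\<^sub>R v"] by (simp add: algebra_simps)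
        finally show "q (c *\<^sub>R x) / c \<le> m (x + t *\<^sub>R v) - t * m v"
          using c by (simp add: field_simps)
      qed
      then show ?thesis using c by (simp add: field_simps)
    qed
    moreover have "q \<le> m"
      using le[of 0] by (simp add: le_fun_def)
    ultimately have "q = m" by (intro min) (auto simp: sublinear_def)
    then have "m (- v) \<le> - m v" using le[of 1 "- v"] m0 by simp
    then show ?thesis using sub[of v "- v"] m0 by simp
  qed
  have add: "m (x + y) = m x + m y" for x y
    using sub[of x y] sub[of "- x" "- y"] odd[of x] odd[of y] odd[of "x + y"] by simp
  have pos: "m (t *\<^sub>R x) = t * m x" if "t > 0" for t x
    using hom[OF that, of x] hom[OF that, of "- x"] odd[of x] odd[of "t *\<^sub>R x"] by simp
  have "m (t *\<^sub>R x) = t * m x" for t x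
    using pos[of t x] pos[of "- t" x] m0 odd[of "t *\<^sub>R x"]
    by (cases t "0::real" rule: linorder_cases) auto
  then have "linear m" by (intro linearI) (auto simp: add)
  then show ?thesis using that \<open>m \<le> p\<close> by (simp add: le_fun_def)
qed

section \<open>Linear minorants of convex sets and Fenchel duality\<close>

text \<open>The lower boundary \<open>p\<close> of the cone generated by \<open>C\<close> is
  sublinear, so a linear functional below \<open>p\<close> also lies below \<open>C\<close>. The
  assumption over the origin keeps \<open>p\<close> finite.\<close>

lemma linear_below_convex_set:
  fixes C :: "('a::real_vector \<times> real) set"
  assumes C: "convex C" and dom: "\<And>z. \<exists>r. (z, r) \<in> C"
    and zero: "\<And>r. (0, r) \<in> C \<Longrightarrow> 0 \<le> r"
  obtains f where "linear f" "\<And>z r. (z, r) \<in> C \<Longrightarrow> f z \<le> r"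
proof -
  define R where "R z = {r / t | r t. t > 0 \<and> (t *\<^sub>R z, r) \<in> C}" for z
  define p where "p z = Inf (R z)" for z
  have R1: "r \<in> R z" if "(z, r) \<in> C" for z r
    unfolding R_def by (intro CollectI exI[of _ r] exI[of _ "1::real"]) (use that in simp)
  have ne: "R z \<noteq> {}" for z
    using R1 dom[of z] by blast
  have add: "a + b \<in> R (z + w)" if "a \<in> R z" "b \<in> R w" for a b z w
  proof -
    obtain r t where t: "t > 0" "(t *\<^sub>R z, r) \<in> C" "a = r / t"
      using \<open>a \<in> R z\<close> by (auto simp: R_def)
    obtain r' s where s: "s > 0" "(s *\<^sub>R w, r') \<in> C" "b = r' / s"
      using \<open>b \<in> R w\<close> by (auto simp: R_def)
    \<comment> \<open>The weights give \<open>z\<close> and \<open>w\<close> the common coefficient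
      \<open>t * s / (t + s)\<close>, so the convex combination lies over a multiple of
      \<open>z + w\<close>.\<close>
    have "(s / (t + s)) *\<^sub>R (t *\<^sub>R z, r) + (t / (t + s)) *\<^sub>R (s *\<^sub>R w, r') \<in> C"
      using C s t by (intro convexD) (auto simp flip: add_divide_distrib simp: add.commute)
    moreover have "(s / (t + s)) *\<^sub>R (t *\<^sub>R z, r) + (t / (t + s)) *\<^sub>R (s *\<^sub>R w, r')
        = ((t * s / (t + s)) *\<^sub>R (z + w), (s * r + t * r') / (t + s))"
      by (simp add: algebra_simps add_divide_distrib)
    moreover have "a + b = ((s * r + t * r') / (t + s)) / (t * s / (t + s))"
    proof -
      have "t + s \<noteq> 0" using s t by simp
      then show ?thesis using s t by (simp add: add_frac_eq mult.commute)
    qed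
    moreover have "t * s / (t + s) > 0" using s t by simp
    ultimately show ?thesis
      unfolding R_def
      by (intro CollectI exI[of _ "(s * r + t * r') / (t + s)"] exI[of _ "t * s / (t + s)"]) metis
  qed
  have R0: "a \<ge> 0" if "a \<in> R 0" for a
    using that zero by (auto simp: R_def)
  \<comment> \<open>Adding a fixed element of \<open>R (- z)\<close> moves \<open>R z\<close> into
    \<open>R 0\<close>, where all values are nonnegative.\<close>
  have bdd: "bdd_below (R z)" for z
  proof -
    obtain b where "b \<in> R (- z)" using ne by blast
    then have "- b \<le> a" if "a \<in> R z" for a
      using R0 add[OF that] by fastforce
    then show ?thesis by (auto simp: bdd_below_def)
  qed
  have le: "p z \<le> a" if "a \<in> R z" for a z
    unfolding p_def by (rule cInf_lower[OF that bdd])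
  have ge: "c \<le> p z" if "\<And>a. a \<in> R z \<Longrightarrow> c \<le> a" for c z
    unfolding p_def by (rule cInf_greatest[OF ne that])
  obtain f where f: "linear f" "\<And>z. f z \<le> p z"
  proof (rule linear_below_sublinear[of p], unfold sublinear_def, intro conjI allI impI)
    fix x y
    have "p (x + y) - a \<le> p y" if "a \<in> R x" for a
      using le[OF add[OF that]] by (intro ge) (smt (verit))
    then have "p (x + y) - p y \<le> p x"
      by (intro ge) (smt (verit))
    then show "p (x + y) \<le> p x + p y" by simp
  next
    fix c :: real and x assume c: "c > 0"
    have "p (c *\<^sub>R x) / c \<le> p x"
    proof (rule ge)
      fix a assume "a \<in> R x"
      then obtain r t where t: "t > 0" "(t *\<^sub>R x, r) \<in> C" "a = r / t"
        by (auto simp: R_def)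
      then have "c * a = r / (t / c)" "t / c > 0" "((t / c) *\<^sub>R (c *\<^sub>R x), r) \<in> C"
        using c by auto
      then have "c * a \<in> R (c *\<^sub>R x)" unfolding R_def by blast
      from le[OF this] show "p (c *\<^sub>R x) / c \<le> a" using c by (simp add: field_simps)
    qed
    then show "p (c *\<^sub>R x) \<le> c * p x" using c by (simp add: field_simps)
  qed blast
  have "f z \<le> r" if "(z, r) \<in> C" for z r
    using le[OF R1[OF that]] f(2)[of z] by simp
  then show ?thesis using that f(1) by blast
qed

text \<open>Fenchel--Rockafellar duality: \<open>D\<close> plays the role of the epigraph of a convex function \<open>k\<close>
  with \<open>k d + g (- d) \<ge> 0\<close>, and the linear functional is a dual solution.\<close>

lemma linear_below_epigraph_sum:
  fixes D :: "('a::real_vector \<times> real) set"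
  assumes D: "convex D" "D \<noteq> {}" and g: "convex_on UNIV g"
    and nonneg: "\<And>d r. (d, r) \<in> D \<Longrightarrow> 0 \<le> r + g (- d)"
  obtains f where "linear f" "\<And>d r e. (d, r) \<in> D \<Longrightarrow> f d + f e \<le> r + g e"
proof -
  \<comment> \<open>Minkowski sum with the epigraph of \<open>g\<close>: over the origin the
    summands are \<open>d\<close> and \<open>- d\<close>, so \<open>nonneg\<close> says exactly that
    heights there are nonnegative.\<close>
  define C where "C = {d + e | d e. d \<in> D \<and> e \<in> epigraph UNIV g}"
  obtain f where f: "linear f" "\<And>z r. (z, r) \<in> C \<Longrightarrow> f z \<le> r"
  proof (rule linear_below_convex_set[of C])
    have "convex (epigraph UNIV g)" using g by (simp add: convex_epigraph)
    moreover have "C = (\<Union>d\<in>D. \<Union>e\<in>epigraph UNIV g. {d + e})" unfolding C_def by blast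
    ultimately show "convex C" using D(1) by (simp add: convex_sums)
    fix z :: 'a
    obtain d r where "(d, r) \<in> D" using D(2) by auto
    then have "(d, r) + (z - d, g (z - d)) \<in> C"
      unfolding C_def epigraph_def by fastforce
    then show "\<exists>r. (z, r) \<in> C" by auto
  next
    fix r assume "(0, r) \<in> C"
    then obtain d s e t where "(d, s) \<in> D" "g e \<le> t" "d + e = 0" "r = s + t"
      unfolding C_def epigraph_def by fastforce
    moreover from this have "e = - d" by (simp add: add_eq_0_iff)
    ultimately show "0 \<le> r" using nonneg by fastforce
  qed blast
  show ?thesis
  proof (rule that[OF f(1)])
    fix d r e assume "(d, r) \<in> D"
    then have "(d, r) + (e, g e) \<in> C"
      unfolding C_def epigraph_def by fastforce
    then show "f d + f e \<le> r + g e"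
      using f(2)[of "d + e" "r + g e"] by (simp add: linear_add[OF f(1)])
  qed
qed

section \<open>Norms, dual norms and half squares\<close>

text \<open>Duality for one point and a translated norm gives
  \<open>f e \<le> norm (z + e) - norm z\<close>. The triangle inequality bounds \<open>f\<close> by
  the norm, and \<open>e = - z\<close> gives attainment.\<close>

lemma norm_attaining_functional:
  fixes z :: "'a::real_normed_vector"
  obtains u :: "'a \<Rightarrow>\<^sub>L real" where "norm u \<le> 1" "blinfun_apply u z = norm z"
proof -
  obtain f where f: "linear f" "\<And>d r e. (d, r) \<in> {(0::'a, - norm z)} \<Longrightarrow> f d + f e \<le> r + norm (z + e)"
  proof (rule linear_below_epigraph_sum[of "{(0::'a, - norm z)}" "\<lambda>e. norm (z + e)"])
    show "convex_on UNIV (\<lambda>e. norm (z + e))"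
      using convex_on_dist[of UNIV "- z"] by (simp add: dist_norm norm_minus_commute add.commute)
  qed auto
  have f0: "f 0 = 0" using f(1) by (rule linear_0)
  have le: "f e \<le> norm e" for e
    using f(2)[of 0 "- norm z" e] f0 norm_triangle_ineq[of z e] by simp
  have abs: "\<bar>f e\<bar> \<le> norm e" for e
    using le[of e] le[of "- e"] linear_neg[OF f(1), of e] by simp
  have bl: "bounded_linear f"
    using f(1) abs by (intro bounded_linear_intro[where K = 1]) (auto simp: linear_add linear_scale)
  have "norm z \<le> f z"
    using f(2)[of 0 "- norm z" "- z"] f0 linear_neg[OF f(1), of z] by simp
  then have "f z = norm z" using le[of z] by simp
  moreover have "norm (Blinfun f) \<le> 1"
    by (rule norm_blinfun_bound) (use abs bl in \<open>auto simp: bounded_linear_Blinfun_apply\<close>)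
  ultimately show ?thesis
    using that[of "Blinfun f"] bl by (simp add: bounded_linear_Blinfun_apply)
qed

text \<open>Evaluation at a norm-attaining functional. It transfers bounds on a bidual functional to
  the point that represents it.\<close>

lemma norm_le_prod_left:
  "norm z \<le> norm (blinfun.prod_left z :: ('a::real_normed_vector \<Rightarrow>\<^sub>L real) \<Rightarrow>\<^sub>L real)"
proof -
  obtain u :: "'a \<Rightarrow>\<^sub>L real" where u: "norm u \<le> 1" "blinfun_apply u z = norm z"
    by (rule norm_attaining_functional)
  have "norm z \<le> norm (blinfun.prod_left z :: ('a \<Rightarrow>\<^sub>L real) \<Rightarrow>\<^sub>L real) * norm u"
    using norm_blinfun[of "blinfun.prod_left z" u] u by simp
  also have "\<dots> \<le> norm (blinfun.prod_left z :: ('a \<Rightarrow>\<^sub>L real) \<Rightarrow>\<^sub>L real) * 1"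
    by (rule mult_left_mono[OF u(1)]) simp
  finally show ?thesis by simp
qed

lemma linear_below_half_square_bound:
  fixes f :: "'a::real_normed_vector \<Rightarrow> real"
  assumes f: "linear f" and le: "\<And>a. f a \<le> c + (norm a)\<^sup>2 / 2"
  shows "\<bar>f a\<bar> \<le> sqrt (2 * c) * norm a"
proof (cases "a = 0")
  case True
  then show ?thesis using f by (simp add: linear_0)
next
  case False
  define n where "n = norm a"
  have n: "n > 0" using False by (simp add: n_def)
  \<comment> \<open>The maximiser of \<open>t * f a - (t * n)\<^sup>2 / 2\<close>.\<close>
  define t where "t = f a / n\<^sup>2"
  have "t * f a \<le> c + (\<bar>t\<bar> * n)\<^sup>2 / 2"
    using le[of "t *\<^sub>R a"] f by (simp add: n_def linear_scale)
  then have "(f a)\<^sup>2 \<le> 2 * c * n\<^sup>2"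
    using n unfolding t_def by (simp add: field_simps power2_eq_square)
  then have "\<bar>f a\<bar> \<le> sqrt (2 * c * n\<^sup>2)"
    using real_sqrt_le_mono by fastforce
  then show ?thesis using n by (simp add: real_sqrt_mult n_def)
qed

lemma bounded_linear_below_half_square:
  fixes f :: "'a::real_normed_vector \<Rightarrow> real"
  assumes "linear f" "\<And>a. f a \<le> c + (norm a)\<^sup>2 / 2"
  shows "bounded_linear f"
  using linear_below_half_square_bound[OF assms] assms(1)
  by (intro bounded_linear_intro[where K = "sqrt (2 * c)"])
    (auto simp: linear_add linear_scale mult.commute)

text \<open>Half the squared dual norm is the conjugate of half the squared norm; this is the
  direction that bounds it by any upper bound \<open>c\<close> of the supremum.\<close>

lemma half_norm_square_le:
  fixes u :: "'a::real_normed_vector \<Rightarrow>\<^sub>L real"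
  assumes le: "\<And>a. blinfun_apply u a \<le> c + (norm a)\<^sup>2 / 2"
  shows "(norm u)\<^sup>2 / 2 \<le> c"
proof -
  have c: "c \<ge> 0" using le[of 0] by simp
  have "\<bar>blinfun_apply u a\<bar> \<le> sqrt (2 * c) * norm a" for a
    using le by (intro linear_below_half_square_bound)
      (auto intro: bounded_linear.linear blinfun.bounded_linear_right)
  then have "norm u \<le> sqrt (2 * c)"
    using c by (intro norm_blinfun_bound) auto
  then have "(norm u)\<^sup>2 \<le> (sqrt (2 * c))\<^sup>2" by (intro power_mono) auto
  then show ?thesis using c by simp
qed

lemma convex_on_norm_square_linear:
  assumes "linear F"
  shows "convex_on UNIV (\<lambda>e. (norm (F e))\<^sup>2)"
proof (rule convex_onI)
  fix t :: real and x y
  assume t: "0 < t" "t < 1"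
  define a b where "a = norm (F x)" and "b = norm (F y)"
  have "norm (F ((1 - t) *\<^sub>R x + t *\<^sub>R y)) \<le> (1 - t) * a + t * b"
    using norm_triangle_ineq[of "(1 - t) *\<^sub>R F x" "t *\<^sub>R F y"] t
    by (simp add: a_def b_def linear_add[OF assms] linear_scale[OF assms])
  then have "(norm (F ((1 - t) *\<^sub>R x + t *\<^sub>R y)))\<^sup>2 \<le> ((1 - t) * a + t * b)\<^sup>2"
    by (intro power_mono) auto
  also have "\<dots> = (1 - t) * a\<^sup>2 + t * b\<^sup>2 - t * (1 - t) * (a - b)\<^sup>2"
    by (simp add: power2_eq_square algebra_simps)
  also have "\<dots> \<le> (1 - t) * a\<^sup>2 + t * b\<^sup>2" using t by simp
  finally show "(norm (F ((1 - t) *\<^sub>R x + t *\<^sub>R y)))\<^sup>2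
      \<le> (1 - t) * (norm (F x))\<^sup>2 + t * (norm (F y))\<^sup>2"
    by (simp add: a_def b_def)
qed simp

section \<open>Maximal monotonicity and the estimate near the graph\<close>

lemma maximally_monotone_memI:
  fixes S :: "'a::real_normed_vector \<Rightarrow> ('a \<Rightarrow>\<^sub>L real) set"
  assumes S: "maximally_monotone S"
    and rel: "\<And>a b. (a, b) \<in> op_graph S \<Longrightarrow> 0 \<le> blinfun_apply (b - w) (a - y)"
  shows "(y, w) \<in> op_graph S"
proof -
  define B where "B = S(y := insert w (S y))"
  have G: "op_graph B = insert (y, w) (op_graph S)"
    by (auto simp: B_def op_graph_def split: if_splits)
  have "0 \<le> blinfun_apply (w - b) (y - a)" if "(a, b) \<in> op_graph S" for a b
    using rel[OF that] by (simp add: blinfun.diff_left blinfun.diff_right)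
  then have "monotone_operator B"
    using S rel unfolding maximally_monotone_def monotone_operator_def G by auto
  then have "op_graph B = op_graph S"
    using S G unfolding maximally_monotone_def by blast
  then show ?thesis using G by blast
qed

text \<open>Young's inequality, with \<open>r\<close> standing for a duality pairing of elements of
  norms \<open>p\<close> and \<open>q\<close>.\<close>

lemma half_square_sum_ge:
  fixes p q r :: real
  assumes "\<bar>r\<bar> \<le> p * q"
  shows "0 \<le> r + (p\<^sup>2 + q\<^sup>2) / 2"
  using assms sum_squares_bound[of p q] by (simp add: field_simps)

text \<open>The Brondsted--Rockafellar property of representative functions on a reflexive space.
  The functional provided by Fenchel duality is, after reflexivity, a pair \<open>(z, u)\<close>, and
  maximality puts \<open>(x + z, v + u)\<close> into the graph.\<close>

lemma near_graph_point:
  fixes S :: "'a::real_normed_vector \<Rightarrow> ('a \<Rightarrow>\<^sub>L real) set"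
  assumes refl: "reflexive_space TYPE('a)" and S: "maximally_monotone S"
    and h: "represents h S"
    and M: "h (x, v) \<le> ereal (M + blinfun_apply v x)"
  obtains a b where "(a, b) \<in> op_graph S" "(norm (a - x))\<^sup>2 + (norm (v - b))\<^sup>2 \<le> 2 * M"
proof -
  \<comment> \<open>\<open>s d\<close> is the pairing at \<open>d + (x, v)\<close> minus the pairing
    at \<open>d\<close>. Hence \<open>D\<close> is the epigraph of a recentred \<open>h\<close> that
    still majorises the pairing, with equality at recentred graph points.\<close>
  define s where "s d = blinfun_apply v (fst d) + blinfun_apply (snd d) x + blinfun_apply v x"
    for d :: "'a \<times> ('a \<Rightarrow>\<^sub>L real)"
  define D where "D = {(d, r). h (d + (x, v)) \<le> ereal (r + s d)}"
  define g where "g e = ((norm (fst e))\<^sup>2 + (norm (snd e))\<^sup>2) / 2"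
    for e :: "'a \<times> ('a \<Rightarrow>\<^sub>L real)"
  have conv: "ereal_convex h" and ge: "\<And>x v. ereal (blinfun_apply v x) \<le> h (x, v)"
    and eq: "\<And>x v. (x, v) \<in> op_graph S \<Longrightarrow> h (x, v) = ereal (blinfun_apply v x)"
    using h unfolding represents_def by auto
  have D0: "(0, M) \<in> D" using M by (simp add: D_def s_def)
  obtain l where l: "linear l" "\<And>d r e. (d, r) \<in> D \<Longrightarrow> l d + l e \<le> r + g e"
  proof (rule linear_below_epigraph_sum[of D g])
    show "convex D"
      unfolding convex_alt
    proof (intro ballI allI impI)
      fix P Q :: "('a \<times> ('a \<Rightarrow>\<^sub>L real)) \<times> real" and t :: real
      assume PQ: "P \<in> D" "Q \<in> D" and t: "0 \<le> t \<and> t \<le> 1"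
      obtain d r where P: "P = (d, r)" by fastforce
      obtain e q where Q: "Q = (e, q)" by fastforce
      have "h ((1 - t) *\<^sub>R d + t *\<^sub>R e + (x, v))
          \<le> ereal ((1 - t) * r + t * q + s ((1 - t) *\<^sub>R d + t *\<^sub>R e))" if t: "0 < t" "t < 1"
      proof -
        have "(1 - t) *\<^sub>R d + t *\<^sub>R e + (x, v) = (1 - t) *\<^sub>R (d + (x, v)) + t *\<^sub>R (e + (x, v))"
          by (simp add: scaleR_add_right scaleR_left_diff_distrib)
        then have "h ((1 - t) *\<^sub>R d + t *\<^sub>R e + (x, v))
            \<le> ereal (1 - t) * h (d + (x, v)) + ereal t * h (e + (x, v))"
          using conv t unfolding ereal_convex_def by presburger
        also have "\<dots> \<le> ereal (1 - t) * ereal (r + s d) + ereal t * ereal (q + s e)"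
          using PQ t by (intro add_mono ereal_mult_left_mono) (auto simp: P Q D_def)
        also have "\<dots> = ereal ((1 - t) * r + t * q + s ((1 - t) *\<^sub>R d + t *\<^sub>R e))"
          by (simp add: s_def blinfun.bilinear_simps algebra_simps)
        finally show ?thesis .
      qed
      then show "(1 - t) *\<^sub>R P + t *\<^sub>R Q \<in> D"
        using PQ t unfolding P Q
        by (cases "t = 0 \<or> t = 1") (auto simp: D_def)
    qed
    show "D \<noteq> {}" using D0 by blast
    have "convex_on UNIV (\<lambda>e. (norm (fst e))\<^sup>2 + (norm (snd e))\<^sup>2 :: real)"
      by (intro convex_on_add convex_on_norm_square_linear linear_fst linear_snd)
    then show "convex_on UNIV g"
      using convex_on_cmul[of "1/2" UNIV] unfolding g_def by fastforce
    fix d r assume "(d, r) \<in> D"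
    then have "ereal (blinfun_apply (snd d + v) (fst d + x)) \<le> ereal (r + s d)"
      using ge[of "snd d + v" "fst d + x"] unfolding D_def
      by (cases d) (auto dest: order_trans)
    then have "blinfun_apply (snd d) (fst d) \<le> r"
      by (simp add: s_def blinfun.bilinear_simps)
    moreover have "0 \<le> blinfun_apply (snd d) (fst d) + g (- d)"
      unfolding g_def using norm_blinfun[of "snd d" "fst d"]
      by (intro order_trans[OF half_square_sum_ge]) (auto simp: mult.commute)
    ultimately show "0 \<le> r + g (- d)" by simp
  qed blast
  \<comment> \<open>\<open>l\<close> is so far only algebraically linear; this quadratic bound is
    what makes both of its components continuous.\<close>
  have l0: "l e \<le> M + g e" for e
    using l(2)[OF D0, of e] linear_0[OF l(1)] by simp
  have lin: "linear (\<lambda>a. l (a, 0))" "linear (\<lambda>b. l (0, b))"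
    using linear_compose[OF _ l(1), of "\<lambda>a. (a, 0)"] linear_compose[OF _ l(1), of "\<lambda>b. (0, b)"]
    by (auto simp: o_def linear_iff)
  define u where "u = Blinfun (\<lambda>a. l (a, 0))"
  define \<xi> where "\<xi> = Blinfun (\<lambda>b. l (0, b))"
  have "bounded_linear (\<lambda>a. l (a, 0))" "bounded_linear (\<lambda>b. l (0, b))"
    using l0[of "(_, 0)"] l0[of "(0, _)"]
    by (auto intro!: bounded_linear_below_half_square[where c = M] lin simp: g_def)
  then have u: "blinfun_apply u a = l (a, 0)" and \<xi>: "blinfun_apply \<xi> b = l (0, b)" for a b
    by (simp_all add: u_def \<xi>_def bounded_linear_Blinfun_apply)
  have split: "l (a, b) = blinfun_apply u a + blinfun_apply \<xi> b" for a b
    using linear_add[OF l(1), of "(a, 0)" "(0, b)"] by (simp add: u \<xi>)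
  \<comment> \<open>Optimising over \<open>e\<close> replaces \<open>g\<close> by its conjugate,
    first in the component \<open>a\<close> and then in \<open>b\<close>.\<close>
  have key: "l d + ((norm u)\<^sup>2 + (norm \<xi>)\<^sup>2) / 2 \<le> r" if "(d, r) \<in> D" for d r
  proof -
    have *: "blinfun_apply u a + blinfun_apply \<xi> b \<le> (r - l d) + (norm a)\<^sup>2 / 2 + (norm b)\<^sup>2 / 2" for a b
      using l(2)[OF that, of "(a, b)"] by (simp add: split g_def add_divide_distrib)
    have "(norm u)\<^sup>2 / 2 \<le> (r - l d) - blinfun_apply \<xi> b + (norm b)\<^sup>2 / 2" for b
      by (rule half_norm_square_le) (use * in \<open>simp add: algebra_simps\<close>)
    then have "(norm \<xi>)\<^sup>2 / 2 \<le> (r - l d) - (norm u)\<^sup>2 / 2"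
      by (intro half_norm_square_le) (simp add: algebra_simps)
    then show ?thesis by (simp add: algebra_simps add_divide_distrib)
  qed
  \<comment> \<open>\<open>\<xi>\<close> lives in the bidual; reflexivity turns it into a point of
    the space.\<close>
  obtain z where z: "\<xi> = blinfun.prod_left z"
    using refl unfolding reflexive_space_def by (metis surjD)
  have "(z + x, u + v) \<in> op_graph S"
  proof (rule maximally_monotone_memI[OF S])
    fix a b assume ab: "(a, b) \<in> op_graph S"
    have "((a - x, b - v), blinfun_apply (b - v) (a - x)) \<in> D"
      by (simp add: D_def s_def eq[OF ab] blinfun.bilinear_simps)
    \<comment> \<open>Together with Young's inequality for the pairing of \<open>z\<close> and
      \<open>u\<close>, this makes all four terms of the expanded monotonicity product sum to a
      nonnegative number.\<close>
    from key[OF this] have "blinfun_apply u (a - x) + blinfun_apply (b - v) z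
        + ((norm u)\<^sup>2 + (norm \<xi>)\<^sup>2) / 2 \<le> blinfun_apply (b - v) (a - x)"
      by (simp add: split z)
    moreover have "0 \<le> blinfun_apply u z + ((norm \<xi>)\<^sup>2 + (norm u)\<^sup>2) / 2"
      using norm_blinfun[of \<xi> u] by (intro half_square_sum_ge) (simp add: z)
    ultimately show "0 \<le> blinfun_apply (b - (u + v)) (a - (z + x))"
      by (simp add: blinfun.bilinear_simps algebra_simps)
  qed
  moreover have "(norm z)\<^sup>2 + (norm u)\<^sup>2 \<le> 2 * M"
  proof -
    have "(norm z)\<^sup>2 \<le> (norm \<xi>)\<^sup>2"
      using norm_le_prod_left[of z] by (intro power_mono) (auto simp: z)
    moreover have "((norm u)\<^sup>2 + (norm \<xi>)\<^sup>2) / 2 \<le> M"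
      using key[OF D0] linear_0[OF l(1)] by simp
    ultimately show ?thesis by argo
  qed
  ultimately show ?thesis using that[of "z + x" "u + v"] by simp
qed

text \<open>The strict bound excludes the default value off the domains and lets some
  \<open>v\<close> in \<open>T y\<close> undercut \<open>M\<close>; the estimate is then applied to
  that \<open>v\<close>.\<close>

lemma bregman_flat_near_graph_point:
  fixes S :: "'a::real_normed_vector \<Rightarrow> ('a \<Rightarrow>\<^sub>L real) set"
  assumes "reflexive_space TYPE('a)" "maximally_monotone S" "represents h S"
    and less: "bregman_flat S T h x y < ereal M"
  obtains a b v where "(a, b) \<in> op_graph S" "(y, v) \<in> op_graph T"
    "(norm (a - x))\<^sup>2 \<le> 2 * M" "(norm (v - b))\<^sup>2 \<le> 2 * M"
proof -
  have "(INF v \<in> T y. h (x, v) - ereal (blinfun_apply v x)) < ereal M"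
    using less unfolding bregman_flat_def by (auto split: if_splits)
  then obtain v where v: "v \<in> T y" "h (x, v) - ereal (blinfun_apply v x) < ereal M"
    by (auto simp: INF_less_iff)
  then have "h (x, v) \<le> ereal (M + blinfun_apply v x)"
    by (cases "h (x, v)") auto
  from near_graph_point[OF assms(1-3) this] obtain a b where "(a, b) \<in> op_graph S"
    and "(norm (a - x))\<^sup>2 + (norm (v - b))\<^sup>2 \<le> 2 * M" .
  moreover from this have "(norm (a - x))\<^sup>2 \<le> 2 * M" "(norm (v - b))\<^sup>2 \<le> 2 * M"
    using zero_le_power2[of "norm (a - x)"] zero_le_power2[of "norm (v - b)"] by linarith+
  ultimately show ?thesis
    using that v(1) unfolding op_graph_def by blast
qed

section \<open>Escaping sequences and the coercivity statements\<close>

lemma frequently_at_infinity_sequence: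
  fixes P :: "'a::real_normed_vector \<Rightarrow> bool"
  assumes "\<not> eventually (\<lambda>y. \<not> P y) at_infinity"
  obtains y where "\<And>n::nat. P (y n)" "\<And>n. real n \<le> norm (y n)"
proof -
  have "\<forall>n::nat. \<exists>y. P y \<and> real n \<le> norm y"
    using assms unfolding eventually_at_infinity by blast
  then show ?thesis using that by metis
qed

text \<open>\<open>L\<close> absorbs a bounded displacement and \<open>c\<close> a lost fraction of
  the norm: \<open>c\<close> is 1 for coercivity and 3/4 for supercoercivity.\<close>

lemma filterlim_at_top_linear:
  fixes f :: "nat \<Rightarrow> real"
  assumes c: "c > 0" and le: "\<And>n. c * real n \<le> f n + L"
  shows "filterlim f at_top sequentially"
  unfolding filterlim_at_top
proof
  fix Z
  show "eventually (\<lambda>n. Z \<le> f n) sequentially"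
  proof (rule eventually_sequentiallyI)
    fix n assume "nat \<lceil>(Z + L) / c\<rceil> \<le> n"
    then have "(Z + L) / c \<le> real n" by linarith
    then have "Z + L \<le> c * real n" using c by (simp add: field_simps)
    then show "Z \<le> f n" using le[of n] by linarith
  qed
qed

theorem theorem4p6:
  fixes S T :: "'a::banach \<Rightarrow> ('a \<Rightarrow>\<^sub>L real) set"
    and h :: "'a \<times> ('a \<Rightarrow>\<^sub>L real) \<Rightarrow> ereal"
    and x :: 'a
  assumes "reflexive_space TYPE('a)"
    and "maximally_monotone S"
    and "represents h S"
    and "x \<in> op_dom S"
  shows "(bounded (op_dom T) \<longrightarrow>
            supercoercive (bregman_flat S T h x) \<and> coercive (bregman_flat S T h x)) \<and>
         ((\<forall>y. compact (T y)) \<longrightarrow>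
            ((\<forall>a b y v.
                (\<forall>n::nat. (a n, b n) \<in> op_graph S) \<and> (\<forall>n. (y n, v n) \<in> op_graph T) \<and>
                filterlim (\<lambda>n. norm (y n - a n)) at_top sequentially \<longrightarrow>
                filterlim (\<lambda>n. norm (v n - b n)) at_top sequentially)
             \<longrightarrow> coercive (bregman_flat S T h x)) \<and>
            ((\<forall>a b y v.
                (\<forall>n::nat. (a n, b n) \<in> op_graph S) \<and> (\<forall>n. (y n, v n) \<in> op_graph T) \<and>
                filterlim (\<lambda>n. norm (y n - a n)) at_top sequentially \<longrightarrow>
                filterlim (\<lambda>n. (norm (v n - b n))\<^sup>2 / norm (y n - a n)) at_top sequentially)
             \<longrightarrow> supercoercive (bregman_flat S T h x)))"
proof (intro conjI impI)
  let ?D = "bregman_flat S T h x"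
  note near = bregman_flat_near_graph_point[OF assms(1-3), of T x]
  {
    assume "bounded (op_dom T)"
    then obtain K where K: "\<And>y. y \<in> op_dom T \<Longrightarrow> norm y \<le> K"
      unfolding bounded_iff by blast
    have out: "?D y = \<infinity>" if "norm y > K" for y
      using K[of y] that by (auto simp: bregman_flat_def)
    have "eventually (\<lambda>y. ?D y = \<infinity>) at_infinity"
      unfolding eventually_at_infinity using out by (intro exI[of _ "K + 1"]) auto
    then show "coercive ?D" unfolding coercive_def by (rule tendsto_eventually)
    have "eventually (\<lambda>y. ?D y / ereal (norm y) = \<infinity>) at_infinity"
      unfolding eventually_at_infinity
    proof (intro exI[of _ "\<bar>K\<bar> + 1"] allI impI)
      fix y :: 'a assume "\<bar>K\<bar> + 1 \<le> norm y"
      then show "?D y / ereal (norm y) = \<infinity>" using out[of y] by (simp add: divide_ereal_def)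
    qed
    then show "supercoercive ?D" unfolding supercoercive_def by (rule tendsto_eventually)
  }
  {
    assume H: "\<forall>a b y v. (\<forall>n::nat. (a n, b n) \<in> op_graph S) \<and> (\<forall>n. (y n, v n) \<in> op_graph T) \<and>
      filterlim (\<lambda>n. norm (y n - a n)) at_top sequentially \<longrightarrow>
      filterlim (\<lambda>n. norm (v n - b n)) at_top sequentially"
    show "coercive ?D"
      unfolding coercive_def tendsto_PInfty
    proof (rule allI, rule ccontr)
      fix r :: real
      assume "\<not> eventually (\<lambda>y. ereal r < ?D y) at_infinity"
      then obtain y where y: "\<And>n::nat. \<not> ereal r < ?D (y n)" "\<And>n. real n \<le> norm (y n)"
        using frequently_at_infinity_sequence[of "\<lambda>y. \<not> ereal r < ?D y"] by auto
      \<comment> \<open>The 2 is that of the estimate, and adding 1 to the absolute value makes the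
        bound on the distance strict and \<open>K\<close> at least 2.\<close>
      define K where "K = 2 * (\<bar>r\<bar> + 1)"
      have "?D (y n) < ereal (\<bar>r\<bar> + 1)" for n
        using y(1)[of n] by (auto simp: not_less intro: le_less_trans)
      then have "\<exists>a b v. (a, b) \<in> op_graph S \<and> (y n, v) \<in> op_graph T \<and>
          (norm (a - x))\<^sup>2 \<le> K \<and> (norm (v - b))\<^sup>2 \<le> K" for n
        unfolding K_def by (rule near) blast
      then obtain a b v where S: "\<And>n. (a n, b n) \<in> op_graph S" and T: "\<And>n. (y n, v n) \<in> op_graph T"
        and ax: "\<And>n. (norm (a n - x))\<^sup>2 \<le> K"
        and vb: "\<And>n. (norm (v n - b n))\<^sup>2 \<le> K"
        by metis
      \<comment> \<open>Since \<open>K\<close> is at least 1, a bound on the square bounds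
        \<open>t\<close> itself, with no square root.\<close>
      have sq: "t \<le> K" if "t\<^sup>2 \<le> K" for t
        using that K_def self_le_power[of t 2] by (cases "t \<ge> 1") auto
      have far: "real n - (norm x + K) \<le> norm (y n - a n)" for n
      proof -
        have "norm (a n - x) \<le> K" using ax by (rule sq)
        then show ?thesis
          using y(2)[of n] norm_triangle_ineq[of "y n - a n" "a n - x"]
            norm_triangle_ineq[of "y n - x" x] by simp
      qed
      then have "filterlim (\<lambda>n. norm (y n - a n)) at_top sequentially"
        by (intro filterlim_at_top_linear[of 1 _ "norm x + K"]) (simp_all add: algebra_simps)
      then have "filterlim (\<lambda>n. norm (v n - b n)) at_top sequentially"
        using H S T by blast
      then have "eventually (\<lambda>n. K < norm (v n - b n)) sequentially"
        by (simp add: filterlim_at_top_dense)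
      then obtain n where "K < norm (v n - b n)"
        using eventually_happens by force
      moreover have "norm (v n - b n) \<le> K"
        using vb by (rule sq)
      ultimately show False by simp
    qed
  }
  {
    assume H: "\<forall>a b y v. (\<forall>n::nat. (a n, b n) \<in> op_graph S) \<and> (\<forall>n. (y n, v n) \<in> op_graph T) \<and>
      filterlim (\<lambda>n. norm (y n - a n)) at_top sequentially \<longrightarrow>
      filterlim (\<lambda>n. (norm (v n - b n))\<^sup>2 / norm (y n - a n)) at_top sequentially"
    show "supercoercive ?D"
      unfolding supercoercive_def tendsto_PInfty
    proof (rule allI, rule ccontr)
      fix r :: real
      assume "\<not> eventually (\<lambda>y. ereal r < ?D y / ereal (norm y)) at_infinity"
      \<comment> \<open>Excluding the origin, which is invisible at infinity, lets the quotient be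
        cleared of its denominator below.\<close>
      then have "\<not> eventually (\<lambda>y. \<not> (?D y / ereal (norm y) \<le> ereal r \<and> y \<noteq> 0)) at_infinity"
      proof (rule contrapos_nn)
        assume "eventually (\<lambda>y. \<not> (?D y / ereal (norm y) \<le> ereal r \<and> y \<noteq> 0)) at_infinity"
        moreover have "eventually (\<lambda>y::'a. y \<noteq> 0) at_infinity"
          unfolding eventually_at_infinity by (intro exI[of _ 1]) auto
        ultimately show "eventually (\<lambda>y. ereal r < ?D y / ereal (norm y)) at_infinity"
          by eventually_elim auto
      qed
      then obtain y where y: "\<And>n::nat. ?D (y n) / ereal (norm (y n)) \<le> ereal r \<and> y n \<noteq> 0"
          "\<And>n. real n \<le> norm (y n)"
        by (rule frequently_at_infinity_sequence) blast
      define K where "K = 2 * (\<bar>r\<bar> + 1)"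
      have K: "K > 0" by (simp add: K_def)
      have "?D (y n) < ereal ((\<bar>r\<bar> + 1) * norm (y n))" for n
      proof -
        have n: "norm (y n) > 0" using y(1)[of n] by simp
        have "?D (y n) \<le> ereal (norm (y n)) * ereal r"
          using y(1)[of n] n ereal_divide_le_pos[of "ereal (norm (y n))" "?D (y n)" "ereal r"] by simp
        also have "\<dots> < ereal ((\<bar>r\<bar> + 1) * norm (y n))"
          using n by (simp add: mult.commute)
        finally show ?thesis .
      qed
      then have "\<exists>a b v. (a, b) \<in> op_graph S \<and> (y n, v) \<in> op_graph T \<and>
          (norm (a - x))\<^sup>2 \<le> K * norm (y n) \<and> (norm (v - b))\<^sup>2 \<le> K * norm (y n)" for n
        unfolding K_def mult.assoc by (rule near) blast
      then obtain a b v where S: "\<And>n. (a n, b n) \<in> op_graph S" and T: "\<And>n. (y n, v n) \<in> op_graph T"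
        and ax: "\<And>n. (norm (a n - x))\<^sup>2 \<le> K * norm (y n)"
        and vb: "\<And>n. (norm (v n - b n))\<^sup>2 \<le> K * norm (y n)"
        by metis
      define L where "L = norm x + K"
      have L: "L > 0" using K by (simp add: L_def add_nonneg_pos)
      \<comment> \<open>Here \<open>a n\<close> may drift from \<open>x\<close>, but only like the
        square root of \<open>norm (y n)\<close>. The inequality
        \<open>K * s \<le> (s / 4 + K)\<^sup>2\<close> trades that root for a quarter of the norm
        plus a constant.\<close>
      have far: "3 / 4 * norm (y n) \<le> norm (y n - a n) + L" for n
      proof -
        have "(norm (a n - x))\<^sup>2 \<le> K * norm (y n)"
          by (rule ax)
        also have "\<dots> \<le> (norm (y n) / 4 + K)\<^sup>2"
          using zero_le_power2[of "norm (y n) / 4 - K"] by (simp add: power2_eq_square algebra_simps)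
        finally have "norm (a n - x) \<le> norm (y n) / 4 + K"
          by (rule power2_le_imp_le) (use K in simp)
        then show ?thesis
          using norm_triangle_ineq[of "y n - a n" "a n - x"]
            norm_triangle_ineq[of "y n - x" x] by (simp add: L_def)
      qed
      have "3 / 4 * real n \<le> norm (y n - a n) + L" for n
        using far[of n] y(2)[of n] by simp
      then have lim: "filterlim (\<lambda>n. norm (y n - a n)) at_top sequentially"
        by (intro filterlim_at_top_linear[of "3 / 4" _ L]) simp_all
      then have "filterlim (\<lambda>n. (norm (v n - b n))\<^sup>2 / norm (y n - a n)) at_top sequentially"
        using H S T by blast
      \<comment> \<open>Once \<open>norm (y n - a n)\<close> exceeds \<open>L\<close>,
        \<open>far\<close> gives \<open>norm (y n) \<le> 8/3 * norm (y n - a n)\<close>; rounding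
        8/3 up to 3 bounds the quotient by \<open>3 * K\<close>.\<close>
      then have "eventually (\<lambda>n. 3 * K < (norm (v n - b n))\<^sup>2 / norm (y n - a n)) sequentially"
        unfolding filterlim_at_top_dense by blast
      moreover have "eventually (\<lambda>n. L < norm (y n - a n)) sequentially"
        using lim by (simp add: filterlim_at_top_dense)
      ultimately have "eventually (\<lambda>n. 3 * K < (norm (v n - b n))\<^sup>2 / norm (y n - a n)
          \<and> L < norm (y n - a n)) sequentially"
        by (rule eventually_conj)
      then obtain n where n: "3 * K < (norm (v n - b n))\<^sup>2 / norm (y n - a n)"
          "L < norm (y n - a n)"
        using eventually_happens by force
      have pos: "0 < norm (y n - a n)" using n(2) L by linarith
      have "(norm (v n - b n))\<^sup>2 \<le> K * norm (y n)"
        by (rule vb)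
      also have "\<dots> \<le> K * (3 * norm (y n - a n))"
        using far[of n] n(2) K L by (intro mult_left_mono) auto
      finally have "(norm (v n - b n))\<^sup>2 / norm (y n - a n) \<le> 3 * K"
        unfolding pos_divide_le_eq[OF pos] by (simp add: algebra_simps)
      then show False using n(1) by simp
    qed
  }
qed

end
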